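(* Let $\mathscr{H}$ be a complex Hilbert space and let $U,V$ be two commuting unitary operators on $\mathscr{H}$ satisfying any one of the following conditions: (i) $U^{n_0}=I$ and $V^{n_0}=I$ for some positive integer $n_0$; (ii) $U^n\to I$ and $V^n\to I$ as $n\to\infty$ in the strong operator topology. If $A,B$ are bounded self-adjoint operators on $\mathscr{H}$ such that $A\leq U^*BU$ and $B\leq V^*AV$, then $A=U^*BU$ and $B=V^*AV$.
   Context: For bounded self-adjoint operators $S,T$ on $\mathscr{H}$, $S\leq T$ means that $\langle (T-S)x,x\rangle\geq 0$ for all $x\in\mathscr{H}$. $I$ denotes the identity operator. *)

theory Defs
  imports "HOL-Analysis.Analysis"
begin

text \<open>
  A complex inner product space is presented as a real inner product space together with a complex
  scalar multiplication and a complex inner product, linear in its first argument, whose real part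
  is the given real inner product.  Hence \<open>norm x = sqrt (Re (cinner x x))\<close>, \<open>cinner x x\<close> is real
  by conjugate symmetry, and positive definiteness is inherited from the class \<open>real_inner\<close>.
\<close>

class complex_inner = real_inner +
  fixes scaleC :: "complex \<Rightarrow> 'a \<Rightarrow> 'a" (infixr \<open>*\<^sub>C\<close> 75)
    and cinner :: "'a \<Rightarrow> 'a \<Rightarrow> complex"
  assumes scaleC_add_right: "c *\<^sub>C (x + y) = c *\<^sub>C x + c *\<^sub>C y"
    and scaleC_add_left: "(c + d) *\<^sub>C x = c *\<^sub>C x + d *\<^sub>C x"
    and scaleC_scaleC: "c *\<^sub>C (d *\<^sub>C x) = (c * d) *\<^sub>C x"
    and scaleC_of_real: "complex_of_real r *\<^sub>C x = scaleR r x"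
    and cinner_commute: "cinner x y = cnj (cinner y x)"
    and cinner_add_left: "cinner (x + y) z = cinner x z + cinner y z"
    and cinner_scaleC_left: "cinner (c *\<^sub>C x) y = c * cinner x y"
    and Re_cinner: "Re (cinner x y) = inner x y"

class complex_hilbert_space = complex_inner + complete_space

instantiation complex :: complex_hilbert_space
begin

definition scaleC_complex :: "complex \<Rightarrow> complex \<Rightarrow> complex"
  where "scaleC_complex c x = c * x"

definition cinner_complex :: "complex \<Rightarrow> complex \<Rightarrow> complex"
  where "cinner_complex x y = x * cnj y"

instance
  by standard
    (auto simp: scaleC_complex_def cinner_complex_def algebra_simps scaleR_conv_of_real
      inner_complex_def)

end

text \<open>
  A bounded operator on a complex Hilbert space is an element of \<open>'a \<Rightarrow>\<^sub>L 'a\<close> (bounded real-linear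
  maps) which is moreover complex linear.
\<close>

definition complex_linear_op :: "('a::complex_inner \<Rightarrow>\<^sub>L 'a) \<Rightarrow> bool"
  where "complex_linear_op T \<longleftrightarrow> (\<forall>c x. T (c *\<^sub>C x) = c *\<^sub>C T x)"

definition is_cadjoint :: "('a::complex_inner \<Rightarrow>\<^sub>L 'a) \<Rightarrow> ('a \<Rightarrow>\<^sub>L 'a) \<Rightarrow> bool"
  where "is_cadjoint T S \<longleftrightarrow> (\<forall>x y. cinner (T x) y = cinner x (S y))"

definition cadjoint :: "('a::complex_hilbert_space \<Rightarrow>\<^sub>L 'a) \<Rightarrow> ('a \<Rightarrow>\<^sub>L 'a)"
  where "cadjoint T = (THE S. is_cadjoint T S)"

definition unitary_op :: "('a::complex_hilbert_space \<Rightarrow>\<^sub>L 'a) \<Rightarrow> bool"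
  where "unitary_op U \<longleftrightarrow> complex_linear_op U \<and>
    cadjoint U o\<^sub>L U = id_blinfun \<and> U o\<^sub>L cadjoint U = id_blinfun"

definition self_adjoint_op :: "('a::complex_hilbert_space \<Rightarrow>\<^sub>L 'a) \<Rightarrow> bool"
  where "self_adjoint_op A \<longleftrightarrow> complex_linear_op A \<and> cadjoint A = A"

definition op_le :: "('a::complex_inner \<Rightarrow>\<^sub>L 'a) \<Rightarrow> ('a \<Rightarrow>\<^sub>L 'a) \<Rightarrow> bool" (infix \<open>\<le>\<^sub>o\<^sub>p\<close> 50)
  where "S \<le>\<^sub>o\<^sub>p T \<longleftrightarrow> (\<forall>x. cinner ((T - S) x) x \<in> \<real>\<^sub>\<ge>\<^sub>0)"

primrec op_power :: "('a::real_normed_vector \<Rightarrow>\<^sub>L 'a) \<Rightarrow> nat \<Rightarrow> ('a \<Rightarrow>\<^sub>L 'a)"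
  where "op_power T 0 = id_blinfun"
  | "op_power T (Suc n) = T o\<^sub>L op_power T n"

text \<open>
  Every bounded complex-linear operator on a Hilbert space has exactly one adjoint, so that the
  description operator in \<open>cadjoint\<close> is well defined.
\<close>

lemma riesz_real:
  fixes f :: "'a::{real_inner,complete_space} \<Rightarrow> real"
  assumes "bounded_linear f"
  shows "\<exists>a. \<forall>x. f x = inner x a"
proof -
  interpret f: bounded_linear f by (fact assms)
  define J where "J x = (norm x)\<^sup>2 / 2 - f x" for x
  obtain K where K: "\<And>x. norm (f x) \<le> norm x * K" using f.bounded by blast
  have lower: "- K\<^sup>2 / 2 \<le> J x" for x
  proof -
    have "f x \<le> norm x * K" using K[of x] by simp
    moreover have "0 \<le> (norm x - K)\<^sup>2" by simp
    ultimately show ?thesis unfolding J_def by (simp add: power2_diff)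
  qed
  define m where "m = Inf (range J)"
  have bdd: "bdd_below (range J)" using lower by (auto intro!: bdd_belowI)
  have mle: "m \<le> J x" for x unfolding m_def using bdd by (simp add: cInf_lower)
  have "\<exists>x. J x < m + inverse (real (Suc n))" for n
  proof -
    have "Inf (range J) < m + inverse (real (Suc n))" by (simp add: m_def)
    then show ?thesis using cInf_lessD[of "range J"] by auto
  qed
  then obtain X where X: "\<And>n. J (X n) < m + inverse (real (Suc n))" by metis
  have par: "(norm (x - y))\<^sup>2 = 4 * (J x + J y - 2 * J ((1/2) *\<^sub>R (x + y)))" for x y
    unfolding J_def power2_norm_eq_inner
    by (simp add: f.add f.scaleR inner_simps inner_commute field_simps)
  have close: "(norm (X i - X j))\<^sup>2 \<le> 8 * inverse (real (Suc n))" if "i \<ge> n" "j \<ge> n" for i j n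
  proof -
    have "inverse (real (Suc i)) \<le> inverse (real (Suc n))"
      "inverse (real (Suc j)) \<le> inverse (real (Suc n))"
      using that by (simp_all add: field_simps)
    then have "J (X i) < m + inverse (real (Suc n))" "J (X j) < m + inverse (real (Suc n))"
      using X[of i] X[of j] by (meson add_left_mono less_le_trans)+
    then have "J (X i) + J (X j) - 2 * J ((1/2) *\<^sub>R (X i + X j)) \<le> 2 * inverse (real (Suc n))"
      using mle[of "(1/2) *\<^sub>R (X i + X j)"] by argo
    then show ?thesis unfolding par[of "X i" "X j"] by argo
  qed
  have "Cauchy X"
  proof (rule CauchyI)
    fix e :: real assume "0 < e"
    then obtain n where n: "inverse (real (Suc n)) < e\<^sup>2 / 8"
      using reals_Archimedean[of "e\<^sup>2 / 8"] by auto
    show "\<exists>M. \<forall>i\<ge>M. \<forall>j\<ge>M. norm (X i - X j) < e"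
    proof (intro exI[of _ n] allI impI)
      fix i j assume "n \<le> i" "n \<le> j"
      then have "(norm (X i - X j))\<^sup>2 < e\<^sup>2" using close[of n i j] n by linarith
      then show "norm (X i - X j) < e" using \<open>0 < e\<close> by (simp add: power_less_imp_less_base)
    qed
  qed
  then obtain a where a: "X \<longlonglongrightarrow> a" using Cauchy_convergent convergent_def by blast
  have "(\<lambda>n. J (X n)) \<longlonglongrightarrow> J a"
    unfolding J_def by (auto intro!: tendsto_intros a f.tendsto)
  moreover have "(\<lambda>n. m + inverse (real (Suc n))) \<longlonglongrightarrow> m + 0"
    by (intro tendsto_intros LIMSEQ_inverse_real_of_nat)
  ultimately have "J a \<le> m + 0"
    by (rule LIMSEQ_le) (use X in \<open>auto intro: less_imp_le\<close>)
  then have min: "J a \<le> J y" for y using mle[of y] by simp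
  have "f x = inner x a" for x
  proof (rule ccontr)
    define d where "d = f x - inner x a"
    assume "f x \<noteq> inner x a"
    then have "d \<noteq> 0" by (simp add: d_def)
    then have "x \<noteq> 0" by (auto simp: d_def f.zero)
    define t where "t = d / inner x x"
    have "J (a + t *\<^sub>R x) = J a - t * d + t\<^sup>2 * inner x x / 2"
      unfolding J_def d_def power2_norm_eq_inner
      by (simp add: f.add f.scaleR inner_simps inner_commute field_simps power2_eq_square)
    also have "\<dots> = J a - d\<^sup>2 / (2 * inner x x)"
      using \<open>x \<noteq> 0\<close> by (simp add: t_def field_simps power2_eq_square)
    also have "\<dots> < J a" using \<open>x \<noteq> 0\<close> \<open>d \<noteq> 0\<close> by simp
    finally show False using min[of "a + t *\<^sub>R x"] by simp
  qed
  then show ?thesis by blast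
qed

lemma Im_cinner: "Im (cinner x y) = - inner (\<i> *\<^sub>C x) y"
  by (simp flip: Re_cinner add: cinner_scaleC_left)

lemma is_cadjoint_unique:
  assumes "is_cadjoint T S" "is_cadjoint T S'"
  shows "S = S'"
proof (rule blinfun_eqI)
  fix y
  have "inner x (S y) = inner x (S' y)" for x
    using assms unfolding is_cadjoint_def by (metis Re_cinner)
  then show "S y = S' y" using vector_eq_ldot by blast
qed

lemma is_cadjoint_cadjoint:
  fixes T :: "'a::complex_hilbert_space \<Rightarrow>\<^sub>L 'a"
  assumes "complex_linear_op T"
  shows "is_cadjoint T (cadjoint T)"
proof -
  have "\<exists>a. \<forall>x. inner (T x) y = inner x a" for y
    by (rule riesz_real) (intro bounded_linear_intros)
  then obtain g where g: "\<And>x y. inner (T x) y = inner x (g y)" by metis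
  have "bounded_linear g"
  proof (rule bounded_linear_intro)
    show "g (x + y) = g x + g y" for x y
      by (rule vector_eq_ldot[THEN iffD1]) (simp add: inner_add_right flip: g)
    show "g (r *\<^sub>R x) = r *\<^sub>R g x" for r x
      by (rule vector_eq_ldot[THEN iffD1]) (simp flip: g)
    show "norm (g x) \<le> norm x * norm T" for x
    proof (cases "g x = 0")
      case False
      have "norm (g x) * norm (g x) = inner (T (g x)) x"
        by (simp add: g dot_square_norm flip: power2_eq_square)
      also have "\<dots> \<le> norm (T (g x)) * norm x" by (rule norm_cauchy_schwarz)
      also have "\<dots> \<le> norm T * norm (g x) * norm x"
        by (intro mult_right_mono norm_blinfun) simp
      finally show ?thesis using False by (simp add: mult.commute mult.left_commute)
    qed simp
  qed
  then have "blinfun_apply (Blinfun g) = g" by (rule bounded_linear_Blinfun_apply)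
  then have "is_cadjoint T (Blinfun g)"
    using assms unfolding is_cadjoint_def complex_linear_op_def
    by (auto simp: complex_eq_iff Re_cinner Im_cinner simp flip: g)
  then show ?thesis
    unfolding cadjoint_def by (metis is_cadjoint_unique theI)
qed

end

theory Submission
  imports Defs
begin

text \<open>
  Alternating the two inequalities along the orbit of \<open>x\<close> gives
  \<open>\<langle>Ax,x\<rangle> \<le> \<langle>BUx,Ux\<rangle> \<le> \<langle>AVUx,VUx\<rangle> \<le> \<dots> \<le> \<langle>A(VU)\<^sup>nx,(VU)\<^sup>nx\<rangle>\<close>.  Either hypothesis makes \<open>(VU)\<^sup>nx\<close>
  return to \<open>x\<close> along a sequence of positive exponents, so all these numbers coincide.  The two
  symmetric operators \<open>A\<close> and \<open>U\<^sup>*BU\<close> therefore have the same quadratic form, and polarization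
  shows that they are equal.
\<close>

text \<open>Kept free of operators so that it serves both equalities: the second arises by
  exchanging the pairs \<open>(a, u)\<close> and \<open>(b, v)\<close>. Continuity of
  \<open>a\<close> carries the lower bound \<open>b (u x)\<close> along the returning orbit to the
  value \<open>a x\<close>.\<close>

lemma quadratic_form_eq_of_recurrence:
  fixes a b :: "'a::t2_space \<Rightarrow> real" and u v :: "'a \<Rightarrow> 'a"
  assumes ab: "\<And>x. a x \<le> b (u x)" and ba: "\<And>x. b x \<le> a (v x)"
    and pos: "\<And>k. 0 < r k"
    and rec: "(\<lambda>k. ((v \<circ> u) ^^ r k) x) \<longlonglongrightarrow> x"
    and cont: "isCont a x"
  shows "a x = b (u x)"
proof (rule antisym[OF ab])
  have step: "a y \<le> a ((v \<circ> u) y)" for y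
    using ab[of y] ba[of "u y"] by simp
  \<comment> \<open>The exponent starts at 1: \<open>b (u x)\<close> lies between \<open>a x\<close>
    and \<open>a (v (u x))\<close>, so exponent 0 would already be the claim. Hence the need for
    \<open>0 < r k\<close>.\<close>
  have chain: "b (u x) \<le> a (((v \<circ> u) ^^ Suc n) x)" for n
  proof (induction n)
    case 0
    then show ?case using ba[of "u x"] by simp
  next
    case (Suc n)
    then show ?case using order_trans[OF Suc step] by (simp add: o_def)
  qed
  have "b (u x) \<le> a (((v \<circ> u) ^^ r k) x)" for k
    using chain[of "r k - 1"] pos[of k] by simp
  moreover have "(\<lambda>k. a (((v \<circ> u) ^^ r k) x)) \<longlonglongrightarrow> a x"
    by (rule isCont_tendsto_compose[OF cont rec])
  ultimately show "b (u x) \<le> a x" by (intro LIMSEQ_le_const) auto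
qed

lemma funpow_comp_commute:
  assumes "f \<circ> g = g \<circ> f"
  shows "(f \<circ> g) ^^ n = (f ^^ n) \<circ> (g ^^ n)"
proof (induction n)
  case (Suc n)
  have "g (f x) = f (g x)" for x
    using assms by (metis comp_apply)
  then have "g ((f ^^ n) x) = (f ^^ n) (g x)" for x
    by (induction n) simp_all
  with Suc show ?case by (simp add: fun_eq_iff)
qed simp

lemma op_power_apply: "op_power T n x = (blinfun_apply T ^^ n) x"
  by (induction n) auto

lemma inner_cadjoint:
  assumes "complex_linear_op T"
  shows "inner (cadjoint T x) y = inner x (T y)"
  using is_cadjoint_cadjoint[OF assms] unfolding is_cadjoint_def
  by (metis Re_cinner inner_commute)

lemma unitary_op_inner:
  assumes "unitary_op U"
  shows "inner (U x) (U y) = inner x y"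
proof -
  have "cadjoint U (U x) = x"
    using assms unfolding unitary_op_def by (metis blinfun_apply_blinfun_compose id_blinfun.rep_eq)
  then show ?thesis
    using assms inner_cadjoint[of U "U x" y] by (simp add: unitary_op_def)
qed

lemma unitary_op_funpow_norm:
  assumes "unitary_op U"
  shows "norm ((blinfun_apply U ^^ n) x) = norm x"
  by (induction n) (simp_all add: norm_eq_sqrt_inner unitary_op_inner[OF assms])

text \<open>Passing to real parts leaves an inequality of real quadratic forms, on which the
  monotone chain runs.\<close>

lemma op_le_inner:
  assumes "S \<le>\<^sub>o\<^sub>p T"
  shows "inner (S x) x \<le> inner (T x) x"
proof -
  have "0 \<le> inner ((T - S) x) x"
    using assms by (simp add: op_le_def complex_nonneg_Reals_iff Re_cinner)
  then show ?thesis by (simp add: blinfun.diff_left inner_diff_left)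
qed

text \<open>Polarization: expanding the forms at \<open>x + y\<close> leaves the cross terms, which
  symmetry merges into twice \<open>inner x (S y)\<close> and twice
  \<open>inner x (T y)\<close>.\<close>

lemma symmetric_blinfun_eqI:
  fixes S T :: "'a::real_inner \<Rightarrow>\<^sub>L 'a"
  assumes symS: "\<And>x y. inner (S x) y = inner x (S y)"
    and symT: "\<And>x y. inner (T x) y = inner x (T y)"
    and eq: "\<And>x. inner (S x) x = inner (T x) x"
  shows "S = T"
proof (rule blinfun_eqI)
  fix y
  have "inner x (S y) = inner x (T y)" for x
    using eq[of "x + y"] eq[of x] eq[of y] symS[of x y] symT[of x y]
    by (simp add: blinfun.add_right inner_add inner_commute)
  then show "S y = T y" using vector_eq_ldot by blast
qed

lemma limitin_strong_operator_topology_apply: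
  assumes "limitin strong_operator_topology f l F"
  shows "((\<lambda>n. blinfun_apply (f n) x) \<longlongrightarrow> l x) F"
  using continuous_map_limit[OF strong_operator_topology_continuous_evaluation assms]
  by (simp add: o_def)

text \<open>Commutation splits \<open>(VU)^n\<close> into \<open>V^n U^n\<close>. The exponents
  \<open>r k\<close> are constantly \<open>n\<^sub>0\<close> in the periodic case and
  \<open>Suc k\<close> in the convergent case, the same for every \<open>x\<close>.\<close>

lemma unitary_ops_recurrence:
  fixes U V :: "'a::complex_hilbert_space \<Rightarrow>\<^sub>L 'a"
  assumes V: "unitary_op V" and comm: "U o\<^sub>L V = V o\<^sub>L U"
    and hyp: "(\<exists>n\<^sub>0>0. op_power U n\<^sub>0 = id_blinfun \<and> op_power V n\<^sub>0 = id_blinfun) \<or>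
      (limitin strong_operator_topology (\<lambda>n. op_power U n) id_blinfun sequentially \<and>
       limitin strong_operator_topology (\<lambda>n. op_power V n) id_blinfun sequentially)"
  obtains r :: "nat \<Rightarrow> nat"
  where "\<And>k. 0 < r k" "\<And>x. (\<lambda>k. ((blinfun_apply V \<circ> blinfun_apply U) ^^ r k) x) \<longlonglongrightarrow> x"
proof -
  let ?W = "blinfun_apply V \<circ> blinfun_apply U"
  have "blinfun_apply V \<circ> blinfun_apply U = blinfun_apply U \<circ> blinfun_apply V"
    using comm by (metis blinfun_compose.rep_eq)
  then have W: "(?W ^^ n) x = op_power V n (op_power U n x)" for n x
    using funpow_comp_commute[of "blinfun_apply V" "blinfun_apply U" n] by (simp add: op_power_apply)
  from hyp show ?thesis
  proof
    assume "\<exists>n\<^sub>0>0. op_power U n\<^sub>0 = id_blinfun \<and> op_power V n\<^sub>0 = id_blinfun"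
    then obtain n\<^sub>0 where "n\<^sub>0 > 0" "op_power U n\<^sub>0 = id_blinfun" "op_power V n\<^sub>0 = id_blinfun"
      by blast
    then show ?thesis by (intro that[of "\<lambda>_. n\<^sub>0"]) (simp_all add: W)
  next
    assume "limitin strong_operator_topology (\<lambda>n. op_power U n) id_blinfun sequentially \<and>
      limitin strong_operator_topology (\<lambda>n. op_power V n) id_blinfun sequentially"
    then have lim: "(\<lambda>n. op_power U n x) \<longlonglongrightarrow> x" "(\<lambda>n. op_power V n x) \<longlonglongrightarrow> x" for x
      by (auto dest: limitin_strong_operator_topology_apply[where x = x])
    have "(\<lambda>n. (?W ^^ n) x) \<longlonglongrightarrow> x" for x
    proof -
      \<comment> \<open>Write \<open>V^n U^n x = V^n (U^n x - x) + V^n x\<close>. The first summand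
        vanishes in the limit because each \<open>V^n\<close> is isometric.\<close>
      have "(\<lambda>n. op_power V n (op_power U n x - x)) \<longlonglongrightarrow> 0"
      proof (rule tendsto_norm_zero_cancel)
        have "norm (op_power V n (op_power U n x - x)) = norm (op_power U n x - x)" for n
          unfolding op_power_apply[of V] by (rule unitary_op_funpow_norm[OF V])
        then show "(\<lambda>n. norm (op_power V n (op_power U n x - x))) \<longlonglongrightarrow> 0"
          using lim(1)[of x] by (simp add: tendsto_norm_zero LIM_zero)
      qed
      from tendsto_add[OF this lim(2)[of x]] show ?thesis
        by (simp add: W blinfun.diff_right)
    qed
    \<comment> \<open>The shift by one makes every exponent positive.\<close>
    then have "(\<lambda>k. (?W ^^ Suc k) x) \<longlonglongrightarrow> x" for x
      by (rule LIMSEQ_Suc)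
    then show ?thesis by (intro that[of Suc]) simp_all
  qed
qed

lemma self_adjoint_conjugation_eqI:
  fixes S T W :: "'a::complex_hilbert_space \<Rightarrow>\<^sub>L 'a"
  assumes S: "self_adjoint_op S" and T: "self_adjoint_op T" and W: "complex_linear_op W"
    and eq: "\<And>x. inner (S x) x = inner (T (W x)) (W x)"
  shows "S = cadjoint W o\<^sub>L T o\<^sub>L W"
proof (rule symmetric_blinfun_eqI)
  have sym: "inner (R x) y = inner x (R y)" if "self_adjoint_op R"
    for R :: "'a \<Rightarrow>\<^sub>L 'a" and x y
    using that inner_cadjoint[of R x y] by (simp add: self_adjoint_op_def)
  show "inner (S x) y = inner x (S y)" for x y
    by (rule sym[OF S])
  have conj: "inner ((cadjoint W o\<^sub>L T o\<^sub>L W) x) y = inner (T (W x)) (W y)" for x y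
    by (simp add: inner_cadjoint[OF W])
  \<comment> \<open>By \<open>conj\<close>, both sides become the form of \<open>T\<close> at
    \<open>W x\<close> and \<open>W y\<close>, so symmetry of \<open>T\<close> passes to its
    conjugate.\<close>
  show "inner ((cadjoint W o\<^sub>L T o\<^sub>L W) x) y = inner x ((cadjoint W o\<^sub>L T o\<^sub>L W) y)" for x y
    using conj[of x y] conj[of y x] sym[OF T, of "W x" "W y"] by (metis inner_commute)
  show "inner (S x) x = inner ((cadjoint W o\<^sub>L T o\<^sub>L W) x) x" for x
    using conj eq by simp
qed

theorem corollary2p6:
  fixes U V A B :: "'a::complex_hilbert_space \<Rightarrow>\<^sub>L 'a"
  assumes "unitary_op U" and "unitary_op V"
    and "U o\<^sub>L V = V o\<^sub>L U"
    and "(\<exists>n\<^sub>0>0. op_power U n\<^sub>0 = id_blinfun \<and> op_power V n\<^sub>0 = id_blinfun) \<or>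
      (limitin strong_operator_topology (\<lambda>n. op_power U n) id_blinfun sequentially \<and>
       limitin strong_operator_topology (\<lambda>n. op_power V n) id_blinfun sequentially)"
    and "self_adjoint_op A" and "self_adjoint_op B"
    and "A \<le>\<^sub>o\<^sub>p cadjoint U o\<^sub>L B o\<^sub>L U"
    and "B \<le>\<^sub>o\<^sub>p cadjoint V o\<^sub>L A o\<^sub>L V"
  shows "A = cadjoint U o\<^sub>L B o\<^sub>L U \<and> B = cadjoint V o\<^sub>L A o\<^sub>L V"
proof -
  obtain r where r: "\<And>k. 0 < r k"
    and rec: "\<And>x. (\<lambda>k. ((blinfun_apply V \<circ> blinfun_apply U) ^^ r k) x) \<longlonglongrightarrow> x"
    using unitary_ops_recurrence[OF assms(2,3,4)] by blast
  have swap: "blinfun_apply V \<circ> blinfun_apply U = blinfun_apply U \<circ> blinfun_apply V"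
    using assms(3) by (metis blinfun_compose.rep_eq)
  have U: "complex_linear_op U" and V: "complex_linear_op V"
    using assms(1,2) by (simp_all add: unitary_op_def)
  define a where "a x = inner (A x) x" for x
  define b where "b x = inner (B x) x" for x
  have ab: "a x \<le> b (U x)" for x
    using op_le_inner[OF assms(7), of x] by (simp add: a_def b_def inner_cadjoint[OF U])
  have ba: "b x \<le> a (V x)" for x
    using op_le_inner[OF assms(8), of x] by (simp add: a_def b_def inner_cadjoint[OF V])
  have cont: "isCont a x" "isCont b x" for x
    unfolding a_def b_def by (intro continuous_intros)+
  have "a x = b (U x)" for x
    using ab ba r rec cont(1) by (rule quadratic_form_eq_of_recurrence)
  \<comment> \<open>With the roles exchanged the orbit map is \<open>U\<close> after
    \<open>V\<close>; by commutation it is the same map, so the same return times serve.\<close>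
  moreover have "b x = a (V x)" for x
    using ba ab r rec[unfolded swap] cont(2) by (rule quadratic_form_eq_of_recurrence)
  ultimately show ?thesis
    using self_adjoint_conjugation_eqI[OF assms(5,6) U] self_adjoint_conjugation_eqI[OF assms(6,5) V]
    by (simp add: a_def b_def)
qed

end
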